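(* Let $(F_m)_{m\in\mathbb{Z}}$ be the Fibonacci numbers. Let $r\ge 0$ be an integer and let $s,k,n$ be integers. Let $D(r,s,k,n)$ be the determinant of the $(r+1)\times(r+1)$ matrix whose $(i,j)$ entry is $F_{s+k(n+i+j)}^r$ for $i,j=0,1,\dots,r$. Then $$D(r,s,k,n)=(-1)^{(s+kn+1)\binom{r+1}{2}}\left(F_k^rF_{2k}^{r-1}\cdots F_{rk}\right)^2\cdot\prod_{i=0}^r \binom{r}{i}.$$
   Context: The Fibonacci numbers are $F_0=0$, $F_1=1$, $F_m=F_{m-1}+F_{m-2}$, extended to negative indices by the same recurrence. The product $F_k^rF_{2k}^{r-1}\cdots F_{rk}$ means $\prod_{\ell=1}^r F_{\ell k}^{r+1-\ell}$ (empty product $1$ if $r=0$), and $0^0=1$. *)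

theory Defs
  imports
    "HOL-Number_Theory.Fib"
    "Jordan_Normal_Form.Determinant"
begin

text \<open>The Fibonacci numbers on all of the integers: downwards from \<open>0, 1\<close> the recurrence is
  read as \<open>F\<^sub>m = F\<^sub>m\<^sub>+\<^sub>2 - F\<^sub>m\<^sub>+\<^sub>1\<close>.\<close>

function fibz :: "int \<Rightarrow> int" where
  "fibz m =
     (if m = 0 then 0
      else if m = 1 then 1
      else if m > 1 then fibz (m - 1) + fibz (m - 2)
      else fibz (m + 2) - fibz (m + 1))"
  by pat_completeness auto
termination
  by (relation "measure (\<lambda>m. nat (if m \<ge> 0 then m else 2 - m))") auto

declare fibz.simps [simp del]

lemma fibz_0 [simp]: "fibz 0 = 0" and fibz_1 [simp]: "fibz 1 = 1"
  by (simp_all add: fibz.simps)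

lemma fibz_rec: "fibz m = fibz (m - 1) + fibz (m - 2)"
proof (cases "m > 1")
  case True
  then show ?thesis by (simp add: fibz.simps [of m])
next
  case False
  then show ?thesis by (simp add: fibz.simps [of "m - 2"])
qed

lemma fibz_of_nat: "fibz (int n) = int (fib n)"
proof (induction n rule: fib.induct)
  case (3 n)
  then show ?case by (simp add: fibz_rec [of "2 + int n"])
qed simp_all

definition fib_power_mat :: "nat \<Rightarrow> int \<Rightarrow> int \<Rightarrow> int \<Rightarrow> int mat" where
  "fib_power_mat r s k n =
     mat (r + 1) (r + 1) (\<lambda>(i, j). fibz (s + k * (n + int i + int j)) ^ r)"

definition fib_power_det :: "nat \<Rightarrow> int \<Rightarrow> int \<Rightarrow> int \<Rightarrow> int" where
  "fib_power_det r s k n = det (fib_power_mat r s k n)"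

end

(* By Binet's formula and the binomial theorem, the (i, j) entry is a power sum
   c_0 x_0^(i+j) + ... + c_r x_r^(i+j) whose nodes are x_t = p^t q^(r-t), where p and q are the
   k-th powers of the golden ratio and of its conjugate. The matrix is therefore V^T diag(c) V
   with V the Vandermonde matrix of the nodes, and each difference of two nodes is
   x_i - x_m = p^m q^(r-i) sqrt 5 F_{k(i-m)} for m < i. *)
theory Submission
  imports Defs Complex_Main
begin

section \<open>Vandermonde and Hankel determinants\<close>

definition newton_poly :: "(nat \<Rightarrow> 'a :: idom) \<Rightarrow> nat \<Rightarrow> 'a poly" where
  "newton_poly x j = (\<Prod>m<j. [:- x m, 1:])"

lemma degree_newton_poly: "degree (newton_poly x j) = j"
  unfolding newton_poly_def by (subst degree_prod_eq_sum_degree) auto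

lemma coeff_newton_poly_self: "coeff (newton_poly x j) j = 1"
  using lead_coeff_prod[of "\<lambda>m. [:- x m, 1:]" "{..<j}"]
  by (simp add: newton_poly_def[symmetric] degree_newton_poly)

lemma poly_newton_poly: "poly (newton_poly x j) y = (\<Prod>m<j. y - x m)"
  by (simp add: newton_poly_def poly_prod)

lemma det_vandermonde:
  fixes x :: "nat \<Rightarrow> 'a :: idom"
  shows "det (mat n n (\<lambda>(i, j). x i ^ j)) = (\<Prod>i<n. \<Prod>m<i. x i - x m)"
proof -
  define V where "V = mat n n (\<lambda>(i, j). x i ^ j)"
  \<comment> \<open>In the Newton basis the Vandermonde matrix is lower triangular, and the change of basis is
    unitriangular.\<close>
  define C where "C = mat n n (\<lambda>(i, j). coeff (newton_poly x j) i)"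
  have [simp]: "V \<in> carrier_mat n n" "C \<in> carrier_mat n n"
    by (simp_all add: V_def C_def)
  then have [simp]: "V * C \<in> carrier_mat n n"
    by (rule mult_carrier_mat)
  have "det C = prod_list (diag_mat C)"
    by (rule det_upper_triangular[of _ n])
      (auto simp: C_def upper_triangular_def intro!: coeff_eq_0 simp: degree_newton_poly)
  also have "\<dots> = 1"
    by (simp add: prod_list_diag_prod C_def coeff_newton_poly_self)
  finally have C: "det C = 1" .
  \<comment> \<open>Column \<open>j\<close> of \<open>C\<close> lists the coefficients of a
    polynomial, so multiplying by \<open>V\<close> evaluates that polynomial at the nodes. For
    \<open>i < j\<close> the factor with \<open>m = i\<close> vanishes, which gives
    triangularity.\<close>
  have VC: "(V * C) $$ (i, j) = (\<Prod>m<j. x i - x m)" if "i < n" "j < n" for i j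
  proof -
    have "(V * C) $$ (i, j) = (\<Sum>a<n. coeff (newton_poly x j) a * x i ^ a)"
      using that by (simp add: V_def C_def scalar_prod_def lessThan_atLeast0 mult.commute)
    also have "\<dots> = (\<Sum>a\<le>j. coeff (newton_poly x j) a * x i ^ a)"
      using that by (intro sum.mono_neutral_right)
        (auto intro!: coeff_eq_0 simp: degree_newton_poly)
    also have "\<dots> = poly (newton_poly x j) (x i)"
      by (simp add: poly_altdef degree_newton_poly)
    finally show ?thesis by (simp add: poly_newton_poly)
  qed
  have "det V = det (V * C)"
    by (simp add: det_mult[of _ n] C)
  also have "\<dots> = prod_list (diag_mat (V * C))"
  proof (rule det_lower_triangular[of n])
    fix i j :: nat assume "i < j" "j < n"
    then show "(V * C) $$ (i, j) = 0" by (auto simp: VC)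
  qed simp
  also have "\<dots> = (\<Prod>i<n. \<Prod>m<i. x i - x m)"
  proof -
    have "dim_row (V * C) = n"
      by (simp add: V_def)
    then show ?thesis
      unfolding prod_list_diag_prod lessThan_atLeast0[symmetric]
      by (intro prod.cong) (simp_all only: VC lessThan_iff)
  qed
  finally show ?thesis by (simp add: V_def)
qed

text \<open>Since \<open>x t ^ (i + j)\<close> splits as \<open>x t ^ i * x t ^ j\<close>, the
  Vandermonde matrix enters once on each side of the diagonal; hence the square.\<close>

lemma det_hankel_power_sum:
  fixes c x :: "nat \<Rightarrow> 'a :: idom"
  shows "det (mat n n (\<lambda>(i, j). \<Sum>t<n. c t * x t ^ (i + j))) =
           (\<Prod>t<n. c t) * (\<Prod>i<n. \<Prod>m<i. x i - x m) ^ 2"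
proof -
  define V where "V = mat n n (\<lambda>(i, j). x i ^ j)"
  define D where "D = mat_diag n c"
  have [simp]: "D \<in> carrier_mat n n" "V \<in> carrier_mat n n"
    by (simp_all add: V_def D_def)
  then have [simp]: "D * V \<in> carrier_mat n n"
    by (rule mult_carrier_mat)
  have DV: "D * V = mat n n (\<lambda>(i, j). c i * x i ^ j)"
    unfolding D_def by (subst mat_diag_mult_left[of _ n n]) (auto simp: V_def)
  have "mat n n (\<lambda>(i, j). \<Sum>t<n. c t * x t ^ (i + j)) = transpose_mat V * (D * V)"
    unfolding DV
    by (rule eq_matI) (auto simp: V_def scalar_prod_def lessThan_atLeast0 power_add ac_simps)
  then have "det (mat n n (\<lambda>(i, j). \<Sum>t<n. c t * x t ^ (i + j))) = det D * det V ^ 2"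
    by (simp add: det_mult[of _ n] det_transpose[of _ n] power2_eq_square)
  moreover have "det D = (\<Prod>t<n. c t)"
    by (subst det_upper_triangular[of _ n])
      (auto simp: D_def mat_diag_def prod_list_diag_prod lessThan_atLeast0)
  ultimately show ?thesis
    by (simp add: V_def det_vandermonde)
qed

section \<open>Golden ratio and Binet's formula at all integer indices\<close>

definition golden :: real where "golden = (1 + sqrt 5) / 2"
definition golden_conj :: real where "golden_conj = (1 - sqrt 5) / 2"

lemma golden_mult_conj: "golden * golden_conj = - 1"
  by (simp add: golden_def golden_conj_def field_simps)

lemma golden_minus_conj: "golden - golden_conj = sqrt 5"
  by (simp add: golden_def golden_conj_def field_simps)

lemma golden_square: "golden ^ 2 = golden + 1" "golden_conj ^ 2 = golden_conj + 1"
  by (simp_all add: golden_def golden_conj_def power2_eq_square field_simps)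

lemma golden_nonzero: "golden \<noteq> 0" "golden_conj \<noteq> 0"
  using golden_mult_conj by auto

text \<open>This is \<open>g ^ 2 = g + 1\<close> multiplied by \<open>g powi (m - 2)\<close>; as
  \<open>g\<close> is nonzero, exponents of either sign add.\<close>

lemma power_int_golden_rec:
  assumes "g \<in> {golden, golden_conj}"
  shows "g powi m = g powi (m - 1) + g powi (m - 2)"
proof -
  have g: "g ^ 2 = g + 1" "g \<noteq> 0"
    using assms golden_nonzero golden_square by (metis insertE singletonD)+
  have "g powi m = g powi (m - 2) * g ^ 2"
    using g power_int_add[of g "m - 2" 2] by simp
  also have "\<dots> = g powi (m - 2) * g + g powi (m - 2)"
    by (simp add: g algebra_simps)
  also have "g powi (m - 2) * g = g powi (m - 1)"
    using g power_int_add[of g "m - 2" 1] by simp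
  finally show ?thesis .
qed

lemma fibz_binet: "real_of_int (fibz m) = (golden powi m - golden_conj powi m) / sqrt 5"
proof (induction m rule: fibz.induct)
  case (1 m)
  consider "m = 0" | "m = 1" | "m > 1" | "m < 0" by linarith
  then show ?case
  proof cases
    case 3
    with 1 show ?thesis
      by (simp add: fibz.simps[of m] power_int_golden_rec[of _ m] field_simps)
  next
    case 4
    with 1 show ?thesis
      \<comment> \<open>For negative \<open>m\<close> the induction supplies the formula at
        \<open>m + 1\<close> and \<open>m + 2\<close>, so the recurrence is taken at
        \<open>m + 2\<close> and solved for its lowest term.\<close>
      using power_int_golden_rec[of golden "m + 2"] power_int_golden_rec[of golden_conj "m + 2"]
      by (simp add: fibz.simps[of m] field_simps)
  qed (simp_all add: golden_minus_conj)
qed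

section \<open>Products over pairs of indices\<close>

text \<open>A difference \<open>l\<close> is realised by the \<open>r + 1 - l\<close> pairs with
  \<open>i\<close> from \<open>l\<close> to \<open>r\<close>.\<close>

lemma prod_pair_diff:
  fixes f :: "nat \<Rightarrow> 'a :: comm_monoid_mult"
  shows "(\<Prod>i<Suc r. \<Prod>m<i. f (i - m)) = (\<Prod>l = 1..r. f l ^ (r + 1 - l))"
proof (induction r)
  case (Suc r)
  have "(\<Prod>m<Suc r. f (Suc r - m)) = (\<Prod>l = 1..Suc r. f l)"
    by (rule prod.reindex_bij_witness[of _ "\<lambda>l. Suc r - l" "\<lambda>m. Suc r - m"]) auto
  moreover have "(\<Prod>l = 1..Suc r. f l ^ (Suc r + 1 - l)) =
      (\<Prod>l = 1..r. f l ^ (r + 1 - l)) * (\<Prod>l = 1..Suc r. f l)"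
  proof -
    \<comment> \<open>At \<open>l = Suc r\<close> the exponent \<open>r + 1 - l\<close> is 0, so
      both factors can share the longer range.\<close>
    have "(\<Prod>l = 1..Suc r. f l ^ (Suc r + 1 - l)) = (\<Prod>l = 1..Suc r. f l ^ (r + 1 - l) * f l)"
      by (intro prod.cong) (auto simp: Suc_diff_le mult.commute)
    then show ?thesis by (simp add: prod.distrib mult.assoc)
  qed
  ultimately show ?case using Suc by simp
qed simp

text \<open>Each \<open>m\<close> is the smaller member of exactly \<open>r - m\<close>
  pairs.\<close>

lemma prod_pair_fst:
  fixes f :: "nat \<Rightarrow> 'a :: comm_monoid_mult"
  shows "(\<Prod>i<Suc r. \<Prod>m<i. f m) = (\<Prod>m<Suc r. f m ^ (r - m))"
proof (induction r)
  case (Suc r)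
  have "(\<Prod>m<Suc r. f m ^ (Suc r - m)) = (\<Prod>m<Suc r. f m ^ (r - m) * f m)"
    by (intro prod.cong) (auto simp: Suc_diff_le mult.commute)
  then show ?case using Suc by (simp add: prod.distrib mult.assoc)
qed simp

lemma sum_lessThan_Suc_choose: "(\<Sum>t<Suc r. t) = Suc r choose 2"
  by (simp add: choose_two gauss_sum_nat lessThan_Suc_atMost atLeast0AtMost[symmetric] Sum_Icc_nat)

lemma sum_diff_lessThan_Suc_choose: "(\<Sum>t<Suc r. r - t) = Suc r choose 2"
  using sum.nat_diff_reindex[of "\<lambda>t. t" "Suc r"] by (simp add: sum_lessThan_Suc_choose[symmetric])

section \<open>Node differences and Binet coefficients\<close>

text \<open>The monomials in \<open>p\<close> and \<open>q\<close> collect into a power of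
  \<open>p * q\<close>, which is a sign and disappears on squaring; every pair leaves one
  \<open>sqrt 5\<close>, which squares to 5.\<close>

lemma prod_root_differences:
  fixes r :: nat and k :: int
  defines "p \<equiv> golden powi k" and "q \<equiv> golden_conj powi k"
  shows "(\<Prod>i<Suc r. \<Prod>m<i. p ^ i * q ^ (r - i) - p ^ m * q ^ (r - m)) ^ 2 =
           5 ^ (Suc r choose 2) * (\<Prod>l = 1..r. real_of_int (fibz (int l * k)) ^ (r + 1 - l)) ^ 2"
proof -
  define F where "F l = real_of_int (fibz (int l * k))" for l
  have F: "p ^ l - q ^ l = sqrt 5 * F l" for l
    unfolding F_def fibz_binet p_def q_def
    by (simp add: power_int_mult mult.commute flip: power_int_power)
  have "p ^ i * q ^ (r - i) - p ^ m * q ^ (r - m) = p ^ m * q ^ (r - i) * (sqrt 5 * F (i - m))"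
    if "i < Suc r" "m < i" for i m
  proof -
    have "p ^ i = p ^ m * p ^ (i - m)" "q ^ (r - m) = q ^ (r - i) * q ^ (i - m)"
      using that by (simp_all flip: power_add)
    then have "p ^ i * q ^ (r - i) - p ^ m * q ^ (r - m) = p ^ m * q ^ (r - i) * (p ^ (i - m) - q ^ (i - m))"
      by (simp only: right_diff_distrib mult.assoc mult.commute mult.left_commute)
    then show ?thesis unfolding F .
  qed
  then have "(\<Prod>i<Suc r. \<Prod>m<i. p ^ i * q ^ (r - i) - p ^ m * q ^ (r - m)) =
      (\<Prod>i<Suc r. \<Prod>m<i. p ^ m * q ^ (r - i) * (sqrt 5 * F (i - m)))"
    by (intro prod.cong) auto
  also have "\<dots> = (\<Prod>i<Suc r. \<Prod>m<i. p ^ m) * (\<Prod>i<Suc r. \<Prod>m<i. q ^ (r - i)) *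
      ((\<Prod>i<Suc r. \<Prod>m<i. sqrt 5) * (\<Prod>i<Suc r. \<Prod>m<i. F (i - m)))"
    by (simp only: prod.distrib)
  \<comment> \<open>Here \<open>p ^ m\<close> occurs \<open>r - m\<close> times and
    \<open>q ^ (r - i)\<close> occurs \<open>i\<close> times, so both exponents have the form
    \<open>m * (r - m)\<close> and the two products merge.\<close>
  also have "(\<Prod>i<Suc r. \<Prod>m<i. p ^ m) * (\<Prod>i<Suc r. \<Prod>m<i. q ^ (r - i)) =
      (\<Prod>m<Suc r. (p * q) ^ (m * (r - m)))"
    unfolding prod_pair_fst prod.distrib[symmetric]
    by (intro prod.cong) (simp_all add: power_mult_distrib mult.commute flip: power_mult)
  also have "(\<Prod>i<Suc r. \<Prod>m<i. sqrt 5) = sqrt 5 ^ (Suc r choose 2)"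
    by (simp only: prod_constant card_lessThan power_sum[symmetric] sum_lessThan_Suc_choose)
  also have "(\<Prod>i<Suc r. \<Prod>m<i. F (i - m)) = (\<Prod>l = 1..r. F l ^ (r + 1 - l))"
    by (rule prod_pair_diff)
  finally have *: "(\<Prod>i<Suc r. \<Prod>m<i. p ^ i * q ^ (r - i) - p ^ m * q ^ (r - m)) =
      (\<Prod>m<Suc r. (p * q) ^ (m * (r - m))) *
      (sqrt 5 ^ (Suc r choose 2) * (\<Prod>l = 1..r. F l ^ (r + 1 - l)))" .
  have "p * q = (- 1) powi k"
    unfolding p_def q_def by (simp flip: power_int_mult_distrib add: golden_mult_conj)
  then have "(p * q) ^ 2 = 1"
    by (simp add: power_int_minus_left)
  then have "((p * q) ^ e) ^ 2 = 1" for e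
    by (simp only: power_mult[symmetric] mult.commute[of e]) (simp only: power_mult power_one)
  then have "(\<Prod>m<Suc r. (p * q) ^ (m * (r - m))) ^ 2 = 1"
    by (simp only: power_sum[symmetric])
  moreover have "(sqrt 5 ^ (Suc r choose 2)) ^ 2 = (5 :: real) ^ (Suc r choose 2)"
    by (simp add: power_mult[symmetric] mult.commute[of _ 2]) (simp add: power_mult)
  ultimately show ?thesis
    unfolding * by (simp add: power_mult_distrib F_def)
qed

text \<open>The factor \<open>5 ^ (Suc r choose 2)\<close>, contributed by the squared node
  differences, cancels the \<open>r + 1\<close> denominators \<open>sqrt 5 ^ r\<close>. The
  exponents of \<open>A\<close> and of \<open>- B\<close> both add up to
  \<open>Suc r choose 2\<close>, so only a power of \<open>- (A * B)\<close>, a sign,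
  remains.\<close>

lemma prod_binet_coefficients:
  fixes r :: nat and a :: int
  defines "A \<equiv> golden powi a" and "B \<equiv> golden_conj powi a"
  shows "(\<Prod>t<Suc r. real (r choose t) * A ^ t * (- B) ^ (r - t) / sqrt 5 ^ r) * 5 ^ (Suc r choose 2) =
           (- 1) powi ((a + 1) * int (Suc r choose 2)) * (\<Prod>t<Suc r. real (r choose t))"
proof -
  let ?N = "Suc r choose 2"
  have "(\<Prod>t<Suc r. real (r choose t) * A ^ t * (- B) ^ (r - t) / sqrt 5 ^ r) =
      (\<Prod>t<Suc r. real (r choose t)) * (\<Prod>t<Suc r. A ^ t) * (\<Prod>t<Suc r. (- B) ^ (r - t)) /
      (sqrt 5 ^ r) ^ Suc r"
    by (simp only: prod_dividef prod.distrib prod_constant card_lessThan)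
  also have "(\<Prod>t<Suc r. A ^ t) = A ^ ?N"
    by (simp only: power_sum[symmetric] sum_lessThan_Suc_choose)
  also have "(\<Prod>t<Suc r. (- B) ^ (r - t)) = (- B) ^ ?N"
    by (simp only: power_sum[symmetric] sum_diff_lessThan_Suc_choose)
  also have "(sqrt 5 ^ r) ^ Suc r = 5 ^ ?N"
  proof -
    have "r * Suc r = 2 * ?N"
      by (simp add: choose_two)
    then show ?thesis
      by (simp only: power_mult[symmetric]) (simp add: power_mult)
  qed
  finally have "(\<Prod>t<Suc r. real (r choose t) * A ^ t * (- B) ^ (r - t) / sqrt 5 ^ r) * 5 ^ ?N =
      (- (A * B)) ^ ?N * (\<Prod>t<Suc r. real (r choose t))"
    by (simp add: power_mult_distrib[symmetric])
  moreover have "A * B = (- 1) powi a"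
    unfolding A_def B_def by (simp flip: power_int_mult_distrib add: golden_mult_conj)
  then have "- (A * B) = (- 1) powi (a + 1)"
    by (simp add: power_int_add)
  ultimately show ?thesis
    by (simp add: power_int_mult)
qed

section \<open>Evaluation of the Fibonacci power determinant\<close>

text \<open>Binet's formula and the binomial theorem, grouped so that \<open>l\<close> occurs only
  as the exponent of the node; this is the power sum needed for the Hankel determinant with
  \<open>l = i + j\<close>.\<close>

lemma fibz_power_expansion:
  "real_of_int (fibz (a + k * int l)) ^ r =
     (\<Sum>t<Suc r. real (r choose t) * (golden powi a) ^ t * (- (golden_conj powi a)) ^ (r - t) / sqrt 5 ^ r *
       ((golden powi k) ^ t * (golden_conj powi k) ^ (r - t)) ^ l)"
proof -
  have "real_of_int (fibz (a + k * int l)) =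
      (golden powi a * (golden powi k) ^ l + - (golden_conj powi a) * (golden_conj powi k) ^ l) / sqrt 5"
    by (simp add: fibz_binet power_int_add golden_nonzero power_int_mult)
  then have "real_of_int (fibz (a + k * int l)) ^ r =
      (\<Sum>t<Suc r. real (r choose t) * (golden powi a * (golden powi k) ^ l) ^ t *
        (- (golden_conj powi a) * (golden_conj powi k) ^ l) ^ (r - t) / sqrt 5 ^ r)"
    by (simp only: power_divide binomial_ring sum_divide_distrib lessThan_Suc_atMost)
  moreover have "u * (a * x ^ l) ^ t * (b * y ^ l) ^ (r - t) / d =
      u * a ^ t * b ^ (r - t) / d * (x ^ t * y ^ (r - t)) ^ l" for u a b x y d :: real and t
  proof -
    have "(z ^ l) ^ t = (z ^ t) ^ l" for z :: real and t
      by (simp add: mult.commute flip: power_mult)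
    then show ?thesis
      by (simp only: power_mult_distrib times_divide_eq_left times_divide_eq_right mult_ac)
  qed
  ultimately show ?thesis by (simp only:)
qed

lemma fib_power_det_real:
  "real_of_int (fib_power_det r s k n) =
     (- 1) powi ((s + k * n + 1) * int (Suc r choose 2)) *
     (\<Prod>l = 1..r. real_of_int (fibz (int l * k)) ^ (r + 1 - l)) ^ 2 *
     (\<Prod>i<Suc r. real (r choose i))"
proof -
  define a where "a = s + k * n"
  define c where "c t = real (r choose t) * (golden powi a) ^ t * (- (golden_conj powi a)) ^ (r - t) / sqrt 5 ^ r" for t
  define x where "x t = (golden powi k) ^ t * (golden_conj powi k) ^ (r - t)" for t
  have "real_of_int (fib_power_det r s k n) = det (map_mat real_of_int (fib_power_mat r s k n))"
    by (simp add: fib_power_det_def)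
  also have "map_mat real_of_int (fib_power_mat r s k n) =
      mat (Suc r) (Suc r) (\<lambda>(i, j). \<Sum>t<Suc r. c t * x t ^ (i + j))"
  proof (rule eq_matI)
    fix i j
    assume "i < dim_row (mat (Suc r) (Suc r) (\<lambda>(i, j). \<Sum>t<Suc r. c t * x t ^ (i + j)))"
      and "j < dim_col (mat (Suc r) (Suc r) (\<lambda>(i, j). \<Sum>t<Suc r. c t * x t ^ (i + j)))"
    then have ij: "i < Suc r" "j < Suc r" by simp_all
    have "s + k * (n + int i + int j) = a + k * int (i + j)"
      by (simp add: a_def algebra_simps)
    with ij show "map_mat real_of_int (fib_power_mat r s k n) $$ (i, j) =
        mat (Suc r) (Suc r) (\<lambda>(i, j). \<Sum>t<Suc r. c t * x t ^ (i + j)) $$ (i, j)"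
      by (simp add: fib_power_mat_def c_def x_def fibz_power_expansion del: of_nat_add sum.lessThan_Suc)
  qed (simp_all add: fib_power_mat_def)
  also have "det \<dots> = (\<Prod>t<Suc r. c t) * (\<Prod>i<Suc r. \<Prod>m<i. x i - x m) ^ 2"
    by (rule det_hankel_power_sum)
  also have "(\<Prod>i<Suc r. \<Prod>m<i. x i - x m) ^ 2 =
      5 ^ (Suc r choose 2) * (\<Prod>l = 1..r. real_of_int (fibz (int l * k)) ^ (r + 1 - l)) ^ 2"
    unfolding x_def by (rule prod_root_differences)
  \<comment> \<open>The power of 5 is regrouped with the coefficients, whose denominators it
    clears.\<close>
  also have "(\<Prod>t<Suc r. c t) * (5 ^ (Suc r choose 2) * (\<Prod>l = 1..r. real_of_int (fibz (int l * k)) ^ (r + 1 - l)) ^ 2) =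
     ((\<Prod>t<Suc r. c t) * 5 ^ (Suc r choose 2)) * (\<Prod>l = 1..r. real_of_int (fibz (int l * k)) ^ (r + 1 - l)) ^ 2"
    by (simp only: mult.assoc)
  also have "(\<Prod>t<Suc r. c t) * 5 ^ (Suc r choose 2) =
      (- 1) powi ((a + 1) * int (Suc r choose 2)) * (\<Prod>t<Suc r. real (r choose t))"
    unfolding c_def by (rule prod_binet_coefficients)
  finally show ?thesis
    by (simp only: a_def mult.assoc mult.commute mult.left_commute)
qed

text \<open>The exponent of \<open>- 1\<close> may be negative, so the identity is stated over a
  field; it is deduced from the real version because \<open>of_rat\<close> is injective.\<close>

theorem mainTheorem2:
  fixes r :: nat and s k n :: int
  shows "(of_int (fib_power_det r s k n) :: rat) =
           (- 1) powi ((s + k * n + 1) * int ((r + 1) choose 2)) *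
           (\<Prod>l = 1..r. of_int (fibz (int l * k)) ^ (r + 1 - l)) ^ 2 *
           (\<Prod>i = 0..r. of_nat (r choose i))"
    (is "?lhs = ?rhs")
proof -
  \<comment> \<open>Both powers depend only on the parity of \<open>z\<close>.\<close>
  have "of_rat ((- 1) powi z) = ((- 1) powi z :: real)" for z
    by (simp add: power_int_minus_left of_rat_minus)
  then have "of_rat ?rhs = real_of_int (fib_power_det r s k n)"
    unfolding fib_power_det_real
    by (simp only: of_rat_mult of_rat_power of_rat_prod of_rat_of_int_eq of_rat_of_nat_eq
        Suc_eq_plus1[symmetric] lessThan_Suc_atMost atLeast0AtMost)
  then have "of_rat ?lhs = (of_rat ?rhs :: real)"
    by simp
  then show ?thesis
    by (simp only: of_rat_eq_iff)
qed

end
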